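(* Let $n$ be a positive integer and let $Z=(z_{ij})$ be a $2n\times 2n$ symmetric complex matrix such that $$\left|1-z_{ij}\right|\le 0.5\quad\text{for all }i,j.$$ Then $\operatorname{haf}Z\ne 0$.
   Context: The hafnian of a $2n\times 2n$ symmetric matrix $Z=(z_{ij})$ is $\operatorname{haf}Z=\sum z_{i_1j_1}\cdots z_{i_nj_n}$, where the sum is over all $(2n)!/(2^n n!)$ unordered partitions of $\{1,\dots,2n\}$ into $n$ pairwise disjoint unordered pairs $\{i_1,j_1\},\dots,\{i_n,j_n\}$. *)

theory Defs
  imports
    Complex_Main
    "HOL-Library.Disjoint_Sets"
    "Jordan_Normal_Form.Matrix"
begin

definition perfect_matchings :: "'a set \<Rightarrow> 'a set set set" where
  "perfect_matchings V = {M. partition_on V M \<and> (\<forall>e\<in>M. card e = 2)}"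

text \<open>
  Rows and columns are numbered from \<open>0\<close>. For a two-element set \<open>e = {i, j}\<close> the factor is read
  off at \<open>(Min e, Max e)\<close>, i.e. in the upper triangle; for symmetric \<open>Z\<close> the order of the two
  indices is immaterial, see \<open>symmetric_pair_entry\<close> below.
\<close>

definition hafnian :: "'a :: comm_semiring_1 mat \<Rightarrow> 'a" where
  "hafnian Z = (\<Sum>M\<in>perfect_matchings {0..<dim_row Z}. \<Prod>e\<in>M. Z $$ (Min e, Max e))"

lemma finite_perfect_matchings:
  assumes "finite V"
  shows "finite (perfect_matchings V)"
proof (rule finite_subset)
  show "perfect_matchings V \<subseteq> Pow (Pow V)"
    by (auto simp: perfect_matchings_def partition_on_def)
  show "finite (Pow (Pow V))"
    using assms by simp
qed

lemma symmetric_pair_entry: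
  assumes "Z \<in> carrier_mat m m" and "transpose_mat Z = Z" and "i < m" and "j < m"
  shows "Z $$ (Min {i, j}, Max {i, j}) = Z $$ (i, j)"
proof -
  have "Z $$ (j, i) = Z $$ (i, j)"
    using assms by (metis carrier_matD index_transpose_mat(1))
  then show ?thesis
    by (cases "i \<le> j") (auto simp: min_def max_def)
qed

end

theory Submission
  imports Defs
begin

text \<open>
  The proof controls not only whether the hafnian vanishes but also how far its argument can move
  (Barvinok's method). Regard the hafnian as a weighted sum over the perfect matchings of a vertex
  set, and let \<open>W\<close> be a set of odd size. Expanding at the vertex \<open>x \<notin> W\<close> gives
  \<open>H (W \<union> {x}) = (\<Sum>w\<in>W. z\<^sub>x\<^sub>w * H (W - {w}))\<close>, and expanding at another vertex \<open>y\<close> gives a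
  combination of the same numbers \<open>H (W - {w})\<close> with other coefficients from the disc of radius
  \<open>1/2\<close> about \<open>1\<close>. The claim proved by induction is that the values \<open>H (W \<union> {x})\<close> and
  \<open>H (W \<union> {y})\<close> are nonzero and form an angle of at most \<open>\<pi>/2\<close>. The hypothesis for smaller sets
  says that the numbers \<open>H (W - {w})\<close> form such angles pairwise, because \<open>W - {w}\<close> and \<open>W - {w'}\<close>
  differ only in having \<open>w'\<close> or \<open>w\<close> as an extra vertex.

  The induction closes by plane geometry (\<open>perturbed_sums_acute\<close>). Numbers with pairwise
  angles at most \<open>\<pi>/2\<close> lie in a common quadrant, so their sum \<open>s\<close> satisfies
  \<open>\<Sum>\<bar>u\<^sub>i\<bar> \<le> \<surd>2 * \<bar>s\<bar>\<close>. Coefficients within \<open>1/2\<close> of \<open>1\<close> then move the sum by at most \<open>\<bar>s\<bar>/\<surd>2\<close>,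
  that is, by an angle of at most \<open>\<pi>/4\<close>; two such perturbations differ by at most \<open>\<pi>/2\<close>.
  Throughout, the angle condition is expressed as \<open>Re (u * cnj v) \<ge> 0\<close>.
\<close>

section \<open>Sums over perfect matchings\<close>

definition matching_sum :: "('a set \<Rightarrow> 'b::comm_semiring_1) \<Rightarrow> 'a set \<Rightarrow> 'b" where
  "matching_sum f V = (\<Sum>M\<in>perfect_matchings V. \<Prod>e\<in>M. f e)"

lemma hafnian_eq_matching_sum:
  "hafnian Z = matching_sum (\<lambda>e. Z $$ (Min e, Max e)) {0..<dim_row Z}"
  by (simp add: hafnian_def matching_sum_def)

lemma matching_sum_empty [simp]:
  fixes f :: "'a set \<Rightarrow> 'b::comm_semiring_1"
  shows "matching_sum f {} = 1"
proof -
  have "perfect_matchings {} = {{} :: 'a set set}"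
    by (auto simp: perfect_matchings_def partition_on_empty)
  then show ?thesis
    by (simp add: matching_sum_def)
qed

lemma insert_edge_perfect_matching:
  assumes "x \<notin> W" "w \<in> W" "M \<in> perfect_matchings (W - {w})"
  shows "insert {x, w} M \<in> perfect_matchings (insert x W)"
proof -
  have M: "partition_on (W - {w}) M" "\<forall>e\<in>M. card e = 2"
    using assms(3) by (auto simp: perfect_matchings_def)
  have "partition_on (insert x W) (insert {x, w} M)"
    unfolding partition_on_def
  proof (intro conjI)
    show "\<Union> (insert {x, w} M) = insert x W"
      using M(1) assms by (auto simp: partition_on_def)
    show "{} \<notin> insert {x, w} M"
      using M(1) by (auto simp: partition_on_def)
    have "disjoint M" and "\<Union> M = W - {w}"
      using M(1) by (auto simp: partition_on_def)
    then show "disjoint (insert {x, w} M)"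
      using assms(1) by (auto simp: pairwise_insert disjnt_def)
  qed
  moreover have "card {x, w} = 2"
    using assms by (auto simp: card_2_iff)
  ultimately show ?thesis
    using M(2) by (auto simp: perfect_matchings_def)
qed

lemma remove_edge_perfect_matching:
  assumes "x \<notin> W" "N \<in> perfect_matchings (insert x W)"
  obtains w M where "w \<in> W" "M \<in> perfect_matchings (W - {w})" "N = insert {x, w} M"
proof -
  have N: "\<Union> N = insert x W" "disjoint N" "{} \<notin> N" "\<forall>e\<in>N. card e = 2"
    using assms(2) by (auto simp: perfect_matchings_def partition_on_def)
  obtain e where e: "e \<in> N" "x \<in> e"
    using N(1) by blast
  then obtain w where w: "e = {x, w}" "w \<noteq> x"
    using N(4) by (metis card_2_iff insertE insert_commute singletonD)
  have "w \<in> W"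
    using e w N(1) by blast
  have disj: "d \<inter> {x, w} = {}" if "d \<in> N - {e}" for d
    using that e(1) w(1) disjointD[OF N(2), of d e] by simp
  have "\<Union> (N - {e}) = W - {w}"
  proof
    show "\<Union> (N - {e}) \<subseteq> W - {w}"
      using disj N(1) by blast
    show "W - {w} \<subseteq> \<Union> (N - {e})"
      using N(1) w assms(1) by blast
  qed
  moreover have "disjoint (N - {e})"
    using N(2) by (auto simp: disjoint_def)
  ultimately have "N - {e} \<in> perfect_matchings (W - {w})"
    using N(3,4) by (auto simp: perfect_matchings_def partition_on_def)
  moreover have "N = insert {x, w} (N - {e})"
    using e w by blast
  ultimately show thesis
    using that \<open>w \<in> W\<close> by blast
qed

text \<open>
  The matchings of \<open>insert x W\<close> are classified by the partner \<open>w\<close> of \<open>x\<close>; this is the analogue for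
  hafnians of the expansion of a permanent along a row.
\<close>

lemma matching_sum_expand:
  assumes "finite W" "x \<notin> W"
  shows "matching_sum f (insert x W) = (\<Sum>w\<in>W. f {x, w} * matching_sum f (W - {w}))"
proof -
  let ?D = "Sigma W (\<lambda>w. perfect_matchings (W - {w}))"
  let ?h = "\<lambda>(w, M). insert {x, w} M"
  have notin: "{x, v} \<notin> M" if "M \<in> perfect_matchings (W - {w})" for v w M
  proof
    assume "{x, v} \<in> M"
    then have "x \<in> \<Union> M"
      by blast
    moreover have "\<Union> M = W - {w}"
      using that by (simp add: perfect_matchings_def partition_on_def)
    ultimately show False
      using assms(2) by simp
  qed
  have inj: "inj_on ?h ?D"
  proof (rule inj_onI, clarify)
    fix w M w' M'
    assume *: "M \<in> perfect_matchings (W - {w})" "M' \<in> perfect_matchings (W - {w'})"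
      "insert {x, w} M = insert {x, w'} M'"
    have "{x, w} \<in> insert {x, w'} M'"
      using *(3) by blast
    then have "{x, w} = {x, w'}"
      using notin[OF *(2), of w] by simp
    then have "w = w'"
      by (auto simp: doubleton_eq_iff)
    moreover have "M = M'"
      using *(3) notin[OF *(1), of w] notin[OF *(2), of w] \<open>w = w'\<close> by (simp add: insert_ident)
    ultimately show "w = w' \<and> M = M'" ..
  qed
  have image: "?h ` ?D = perfect_matchings (insert x W)"
  proof
    show "?h ` ?D \<subseteq> perfect_matchings (insert x W)"
      using insert_edge_perfect_matching[OF assms(2)] by auto
    show "perfect_matchings (insert x W) \<subseteq> ?h ` ?D"
    proof
      fix N assume "N \<in> perfect_matchings (insert x W)"
      then obtain w M where "w \<in> W" "M \<in> perfect_matchings (W - {w})" "N = insert {x, w} M"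
        using remove_edge_perfect_matching[OF assms(2)] by metis
      then show "N \<in> ?h ` ?D"
        by force
    qed
  qed
  have "finite M" if "M \<in> perfect_matchings (W - {w})" for w M
    using that assms(1)
    by (auto simp: perfect_matchings_def intro: finite_elements[rotated])
  then have split: "(\<Prod>e\<in>insert {x, w} M. f e) = f {x, w} * (\<Prod>e\<in>M. f e)"
    if "M \<in> perfect_matchings (W - {w})" for w M
    using that notin by (metis prod.insert)
  have "matching_sum f (insert x W) = (\<Sum>(w, M)\<in>?D. \<Prod>e\<in>insert {x, w} M. f e)"
    unfolding matching_sum_def image[symmetric] sum.reindex[OF inj]
    by (simp add: comp_def case_prod_unfold)
  also have "\<dots> = (\<Sum>(w, M)\<in>?D. f {x, w} * (\<Prod>e\<in>M. f e))"
    by (rule sum.cong) (auto simp: split)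
  also have "\<dots> = (\<Sum>w\<in>W. f {x, w} * matching_sum f (W - {w}))"
    using assms(1)
    by (simp add: sum.Sigma[symmetric] finite_perfect_matchings matching_sum_def sum_distrib_left)
  finally show ?thesis .
qed

section \<open>Complex numbers at pairwise angles at most \<open>\<pi>/2\<close>\<close>

text \<open>
  The witness is the number \<open>u k\<close> of least argument. If a new number has negative argument
  relative to the old extreme one, it becomes the extreme one itself: arguments relative to it are
  sums of two angles in \<open>[0, \<pi>/2]\<close>, so their sines stay nonnegative.
\<close>

lemma acute_family_in_quadrant:
  fixes u :: "'a \<Rightarrow> complex"
  assumes "finite I" "I \<noteq> {}"
    and "\<And>i. i \<in> I \<Longrightarrow> u i \<noteq> 0"
    and "\<And>i j. i \<in> I \<Longrightarrow> j \<in> I \<Longrightarrow> 0 \<le> Re (u i * cnj (u j))"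
  shows "\<exists>k\<in>I. \<forall>i\<in>I. 0 \<le> Im (u i * cnj (u k))"
  using assms
proof (induction I rule: finite_ne_induct)
  case (singleton i)
  then show ?case
    by simp
next
  case (insert x I)
  have "\<exists>k\<in>I. \<forall>i\<in>I. 0 \<le> Im (u i * cnj (u k))"
    by (rule insert.IH) (use insert.prems in blast)+
  then obtain k where k: "k \<in> I" "\<And>i. i \<in> I \<Longrightarrow> 0 \<le> Im (u i * cnj (u k))"
    by blast
  show ?case
  proof (cases "0 \<le> Im (u x * cnj (u k))")
    case True
    then show ?thesis
      using k by blast
  next
    case False
    have "0 \<le> Im (u i * cnj (u x))" if "i \<in> I" for i
    proof -
      have "(cmod (u k))\<^sup>2 * Im (u i * cnj (u x)) =
          Im ((u i * cnj (u k)) * cnj (u x * cnj (u k)))"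
        unfolding cmod_power2 by (simp add: power2_eq_square algebra_simps)
      also have "\<dots> = Im (u i * cnj (u k)) * Re (u x * cnj (u k))
          - Re (u i * cnj (u k)) * Im (u x * cnj (u k))"
        by (simp add: algebra_simps)
      also have "\<dots> \<ge> 0"
      proof -
        have "0 \<le> Im (u i * cnj (u k)) * Re (u x * cnj (u k))"
          using k insert.prems(2) that by (intro mult_nonneg_nonneg) auto
        moreover have "Re (u i * cnj (u k)) * Im (u x * cnj (u k)) \<le> 0"
          using k insert.prems(2) that False by (intro mult_nonneg_nonpos) auto
        ultimately show ?thesis
          by linarith
      qed
      finally show ?thesis
        using insert.prems(1) k(1) by (simp add: zero_le_mult_iff)
    qed
    then show ?thesis
      by (intro bexI[of _ x]) auto
  qed
qed

lemma sum_norm_le_of_acute: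
  fixes u :: "'a \<Rightarrow> complex"
  assumes "finite I"
    and "\<And>i. i \<in> I \<Longrightarrow> u i \<noteq> 0"
    and "\<And>i j. i \<in> I \<Longrightarrow> j \<in> I \<Longrightarrow> 0 \<le> Re (u i * cnj (u j))"
  shows "(\<Sum>i\<in>I. cmod (u i)) \<le> sqrt 2 * cmod (\<Sum>i\<in>I. u i)"
proof (cases "I = {}")
  case False
  then obtain k where k: "k \<in> I" "\<And>i. i \<in> I \<Longrightarrow> 0 \<le> Im (u i * cnj (u k))"
    using acute_family_in_quadrant[of I u] assms by blast
  \<comment> \<open>Multiplication by \<open>cnj (u k)\<close> moves all the numbers into the first quadrant, where the norm
      is at most the sum of the coordinates, which is additive.\<close>
  let ?z = "(\<Sum>i\<in>I. u i) * cnj (u k)"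
  have "(\<Sum>i\<in>I. cmod (u i)) * cmod (u k) = (\<Sum>i\<in>I. cmod (u i * cnj (u k)))"
    by (simp add: norm_mult sum_distrib_right)
  also have "\<dots> \<le> (\<Sum>i\<in>I. Re (u i * cnj (u k)) + Im (u i * cnj (u k)))"
  proof (rule sum_mono)
    fix i assume "i \<in> I"
    then have "0 \<le> Re (u i * cnj (u k))" "0 \<le> Im (u i * cnj (u k))"
      using assms(3) k by blast+
    then show "cmod (u i * cnj (u k)) \<le> Re (u i * cnj (u k)) + Im (u i * cnj (u k))"
      using cmod_le[of "u i * cnj (u k)"] by linarith
  qed
  also have "\<dots> = Re ?z + Im ?z"
    by (simp only: sum_distrib_right Re_sum Im_sum sum.distrib)
  also have "\<dots> \<le> \<bar>Re ?z\<bar> + \<bar>Im ?z\<bar>"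
    by linarith
  also have "\<dots> \<le> sqrt 2 * cmod ?z"
    by (rule complex_abs_le_norm)
  also have "\<dots> = sqrt 2 * cmod (\<Sum>i\<in>I. u i) * cmod (u k)"
    by (simp add: norm_mult)
  finally show ?thesis
    using assms(2) k(1) by simp
qed simp

text \<open>
  The disc of radius \<open>1/\<surd>2\<close> about \<open>1\<close> is inscribed in the quadrant of directions within \<open>\<pi>/4\<close> of
  the positive real axis.
\<close>

lemma disc_around_one_in_quadrant:
  assumes "sqrt 2 * cmod (z - 1) \<le> 1"
  shows "\<bar>Im z\<bar> \<le> Re z"
  using complex_abs_le_norm[of "z - 1"] assms by simp

lemma perturbed_sums_acute:
  fixes u a b :: "'a \<Rightarrow> complex"
  assumes "finite I" "I \<noteq> {}"
    and nz: "\<And>i. i \<in> I \<Longrightarrow> u i \<noteq> 0"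
    and acute: "\<And>i j. i \<in> I \<Longrightarrow> j \<in> I \<Longrightarrow> 0 \<le> Re (u i * cnj (u j))"
    and a: "\<And>i. i \<in> I \<Longrightarrow> cmod (1 - a i) \<le> 1 / 2"
    and b: "\<And>i. i \<in> I \<Longrightarrow> cmod (1 - b i) \<le> 1 / 2"
  shows "(\<Sum>i\<in>I. a i * u i) \<noteq> 0"
    and "0 \<le> Re ((\<Sum>i\<in>I. a i * u i) * cnj (\<Sum>i\<in>I. b i * u i))"
proof -
  define s where "s = (\<Sum>i\<in>I. u i)"
  have le: "(\<Sum>i\<in>I. cmod (u i)) \<le> sqrt 2 * cmod s"
    unfolding s_def by (rule sum_norm_le_of_acute) (use assms in auto)
  have "0 < (\<Sum>i\<in>I. cmod (u i))"
    using assms(1,2) nz by (intro sum_pos) auto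
  then have "s \<noteq> 0"
    using le by auto
  have near: "sqrt 2 * cmod ((\<Sum>i\<in>I. c i * u i) / s - 1) \<le> 1"
    if c: "\<And>i. i \<in> I \<Longrightarrow> cmod (1 - c i) \<le> 1 / 2" for c
  proof -
    have "cmod ((\<Sum>i\<in>I. c i * u i) - s) = cmod (\<Sum>i\<in>I. (c i - 1) * u i)"
      by (simp add: s_def sum_subtractf algebra_simps)
    also have "\<dots> \<le> (\<Sum>i\<in>I. 1 / 2 * cmod (u i))"
    proof (rule sum_norm_le)
      fix i assume "i \<in> I"
      then show "cmod ((c i - 1) * u i) \<le> 1 / 2 * cmod (u i)"
        unfolding norm_mult using c[of i] by (intro mult_right_mono) (auto simp: norm_minus_commute)
    qed
    also have "\<dots> \<le> sqrt 2 / 2 * cmod s"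
      using le by (simp add: sum_divide_distrib[symmetric])
    finally have "sqrt 2 * cmod ((\<Sum>i\<in>I. c i * u i) - s) \<le> sqrt 2 * (sqrt 2 / 2 * cmod s)"
      by (rule mult_left_mono) simp
    also have "\<dots> = cmod s"
      by simp
    finally have "sqrt 2 * cmod ((\<Sum>i\<in>I. c i * u i) - s) \<le> cmod s" .
    moreover have "(\<Sum>i\<in>I. c i * u i) / s - 1 = ((\<Sum>i\<in>I. c i * u i) - s) / s"
      using \<open>s \<noteq> 0\<close> by (simp add: diff_divide_distrib)
    ultimately show ?thesis
      using \<open>s \<noteq> 0\<close> by (simp add: norm_divide divide_simps)
  qed
  define p q where "p = (\<Sum>i\<in>I. a i * u i) / s" and "q = (\<Sum>i\<in>I. b i * u i) / s"
  show "(\<Sum>i\<in>I. a i * u i) \<noteq> 0"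
  proof
    assume "(\<Sum>i\<in>I. a i * u i) = 0"
    then have "sqrt 2 \<le> 1"
      using near[of a] a by simp
    then show False
      by simp
  qed
  have "\<bar>Im p\<bar> \<le> Re p" "\<bar>Im q\<bar> \<le> Re q"
    unfolding p_def q_def using near a b by (blast intro: disc_around_one_in_quadrant)+
  then have "\<bar>Im p * Im q\<bar> \<le> Re p * Re q"
    unfolding abs_mult by (intro mult_mono) auto
  then have "0 \<le> Re (p * cnj q)"
    by simp
  then have "0 \<le> (cmod s)\<^sup>2 * Re (p * cnj q)"
    by simp
  also have "\<dots> = Re ((s * cnj s) * (p * cnj q))"
    by (simp only: complex_norm_square[symmetric] scaleR_conv_of_real[symmetric] scaleR_complex.simps)
  also have "(s * cnj s) * (p * cnj q) = (s * p) * cnj (s * q)"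
    by simp
  also have "\<dots> = (\<Sum>i\<in>I. a i * u i) * cnj (\<Sum>i\<in>I. b i * u i)"
    using \<open>s \<noteq> 0\<close> by (simp add: p_def q_def)
  finally show "0 \<le> Re ((\<Sum>i\<in>I. a i * u i) * cnj (\<Sum>i\<in>I. b i * u i))" .
qed

section \<open>Nonvanishing of the hafnian\<close>

text \<open>
  Exchanging one vertex turns the value by at most \<open>\<pi>/2\<close>. Nonvanishing alone would not carry the
  induction, since nonzero terms may cancel; the angle bound on the terms prevents that.
\<close>

lemma matching_sum_exchange_acute:
  fixes f :: "'a set \<Rightarrow> complex"
  assumes f: "\<And>v w. v \<in> A \<Longrightarrow> w \<in> A \<Longrightarrow> cmod (1 - f {v, w}) \<le> 1 / 2"
    and "finite W" "W \<subseteq> A" "odd (card W)" "x \<in> A - W" "y \<in> A - W"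
  shows "matching_sum f (insert x W) \<noteq> 0 \<and>
    0 \<le> Re (matching_sum f (insert x W) * cnj (matching_sum f (insert y W)))"
  using assms(2-)
proof (induction "card W" arbitrary: W x y rule: less_induct)
  case less
  let ?u = "\<lambda>w. matching_sum f (W - {w})"
  have fin: "finite W"
    by fact
  have exchange: "?u w \<noteq> 0 \<and> 0 \<le> Re (?u w * cnj (?u w'))"
    if "w \<in> W" "w' \<in> W" "w \<noteq> w'" for w w'
  proof -
    let ?W = "W - {w, w'}"
    have card: "card W = Suc (Suc (card ?W))"
      using fin that card_Suc_Diff1[of W w] card_Suc_Diff1[of "W - {w}" w']
      by (simp add: insert_commute flip: Diff_insert2)
    have eq: "W - {w} = insert w' ?W" "W - {w'} = insert w ?W"
      using that by blast+
    have smaller: "card ?W < card W" "odd (card ?W)"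
      using card less.prems by auto
    have subset: "finite ?W" "?W \<subseteq> A" "w' \<in> A - ?W" "w \<in> A - ?W"
      using fin that less.prems by auto
    show ?thesis
      unfolding eq by (rule less.hyps[OF smaller(1) subset(1,2) smaller(2) subset(3,4)])
  qed
  \<comment> \<open>The induction is anchored at a single vertex \<open>w\<close>, where \<open>?u w = matching_sum f {} = 1\<close>.\<close>
  have nz: "?u w \<noteq> 0" if "w \<in> W" for w
  proof (cases "W = {w}")
    case False
    with \<open>w \<in> W\<close> obtain w' where "w' \<in> W" "w \<noteq> w'"
      by blast
    then show ?thesis
      using exchange that by blast
  qed simp
  have acute: "0 \<le> Re (?u w * cnj (?u w'))" if "w \<in> W" "w' \<in> W" for w w'
  proof (cases "w = w'")
    case True
    then show ?thesis
      by simp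
  qed (use exchange that in blast)
  have "W \<noteq> {}"
    using less.prems by auto
  have f_xy: "cmod (1 - f {x, w}) \<le> 1 / 2" "cmod (1 - f {y, w}) \<le> 1 / 2" if "w \<in> W" for w
    using that f less.prems by blast+
  have "(\<Sum>w\<in>W. f {x, w} * ?u w) \<noteq> 0 \<and>
      0 \<le> Re ((\<Sum>w\<in>W. f {x, w} * ?u w) * cnj (\<Sum>w\<in>W. f {y, w} * ?u w))"
    by (intro conjI perturbed_sums_acute[where b = "\<lambda>w. f {y, w}"] fin \<open>W \<noteq> {}\<close> nz acute f_xy)
  then show ?case
    using less.prems by (simp add: matching_sum_expand)
qed

theorem theorem2p4:
  fixes n :: nat and Z :: "complex mat"
  assumes "n \<ge> 1"
    and "Z \<in> carrier_mat (2 * n) (2 * n)"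
    and "transpose_mat Z = Z"
    and "\<And>i j. i < 2 * n \<Longrightarrow> j < 2 * n \<Longrightarrow> cmod (1 - Z $$ (i, j)) \<le> 1 / 2"
  shows "hafnian Z \<noteq> 0"
proof -
  let ?f = "\<lambda>e. Z $$ (Min e, Max e)"
  let ?W = "{1..<2 * n}"
  have bound: "cmod (1 - ?f {v, w}) \<le> 1 / 2" if "v \<in> {0..<2 * n}" "w \<in> {0..<2 * n}" for v w
    using that by (intro assms(4)) auto
  have "odd (card ?W)"
    using assms(1) by simp
  then have "matching_sum ?f (insert 0 ?W) \<noteq> 0"
    using matching_sum_exchange_acute[of "{0..<2 * n}" ?f ?W 0 0] bound assms(1) by auto
  moreover have "insert 0 ?W = {0..<dim_row Z}"
    using assms(1,2) by auto
  ultimately show ?thesis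
    by (simp add: hafnian_eq_matching_sum)
qed

end
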